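(* If $G$ is a claw-free CIS graph, then $|V(G)|\le \alpha(G)\cdot\omega(G)$.
   Context: All graphs are finite, simple and non-null. A graph is CIS if every inclusion-maximal clique intersects every inclusion-maximal stable set. The claw is $K_{1,3}$; claw-free means no induced claw. $\alpha(G)$ and $\omega(G)$ are the maximum sizes of a stable set and of a clique in $G$. *)

theory Defs
  imports "Graph_Theory.Kuratowski"
begin

text \<open>
  A finite simple graph is a digraph satisfying the locale predicate \<^const>\<open>graph\<close>: finite,
  loop-free, without parallel arcs and symmetric. The undirected edge \<open>uv\<close> is the pair of
  opposite arcs, so adjacency is \<open>u \<rightarrow>\<^bsub>G\<^esub> v\<close>.
\<close>

definition clique :: "('a, 'b) pre_digraph \<Rightarrow> 'a set \<Rightarrow> bool" where
  "clique G K \<longleftrightarrow> K \<subseteq> verts G \<and> (\<forall>u\<in>K. \<forall>v\<in>K. u \<noteq> v \<longrightarrow> u \<rightarrow>\<^bsub>G\<^esub> v)"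

definition stable_set :: "('a, 'b) pre_digraph \<Rightarrow> 'a set \<Rightarrow> bool" where
  "stable_set G S \<longleftrightarrow> S \<subseteq> verts G \<and> (\<forall>u\<in>S. \<forall>v\<in>S. u \<noteq> v \<longrightarrow> \<not> u \<rightarrow>\<^bsub>G\<^esub> v)"

definition maximal_clique :: "('a, 'b) pre_digraph \<Rightarrow> 'a set \<Rightarrow> bool" where
  "maximal_clique G K \<longleftrightarrow> clique G K \<and> (\<forall>K'. clique G K' \<and> K \<subseteq> K' \<longrightarrow> K' = K)"

definition maximal_stable_set :: "('a, 'b) pre_digraph \<Rightarrow> 'a set \<Rightarrow> bool" where
  "maximal_stable_set G S \<longleftrightarrow> stable_set G S \<and> (\<forall>S'. stable_set G S' \<and> S \<subseteq> S' \<longrightarrow> S' = S)"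

definition CIS :: "('a, 'b) pre_digraph \<Rightarrow> bool" where
  "CIS G \<longleftrightarrow> (\<forall>K S. maximal_clique G K \<and> maximal_stable_set G S \<longrightarrow> K \<inter> S \<noteq> {})"

definition claw_free :: "('a, 'b) pre_digraph \<Rightarrow> bool" where
  "claw_free G \<longleftrightarrow> \<not> (\<exists>H. induced_subgraph H G \<and> complete_bipartite_digraph 1 3 H)"

definition stability_number :: "('a, 'b) pre_digraph \<Rightarrow> nat" where
  "stability_number G = Max (card ` {S. stable_set G S})"

definition clique_number :: "('a, 'b) pre_digraph \<Rightarrow> nat" where
  "clique_number G = Max (card ` {K. clique G K})"

end

theory Submission
  imports Defs
begin

text \<open>
  Deleting the closed neighbourhood of a stable set \<open>T\<close> preserves the hypotheses and lowers the
  stability number by at least \<open>|T|\<close>. Hence induction applies as soon as some nonempty \<open>T\<close> has a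
  closed neighbourhood of at most \<open>|T| \<omega>\<close> vertices. A simplicial vertex is such a \<open>T\<close>. If some
  neighbourhood contains an induced 4-cycle, then the component of that vertex has stability
  number 2 and is covered by two cliques, so a pair of opposite vertices of the cycle is such a \<open>T\<close>.
  Otherwise, since neighbourhoods contain no induced \<open>P\<^sub>4\<close>, every vertex lies in exactly two maximal
  cliques. A maximal stable set \<open>S\<close> meets each maximal clique exactly once, so there are \<open>2 |S|\<close>
  maximal cliques, and adding up their sizes gives \<open>2 |V| \<le> 2 |S| \<omega>\<close>.
\<close>

section \<open>Maximal sets and the axiomatic setting\<close>

lemma extend_to_maximal:
  assumes "P Q" "\<And>X. P X \<Longrightarrow> X \<subseteq> W" "finite W"
  shows "\<exists>X. P X \<and> Q \<subseteq> X \<and> (\<forall>Y. P Y \<and> X \<subseteq> Y \<longrightarrow> Y = X)"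
proof -
  have "finite {X. P X}"
    by (rule finite_subset[of _ "Pow W"]) (use assms in auto)
  then show ?thesis
    using finite_has_maximal2[of "{X. P X}" Q] assms(1) by auto
qed

text \<open>
  The assumption \<open>settled\<close> is the CIS property without maximality: extend \<open>Q\<close> and \<open>T\<close> to maximal
  sets and take a common vertex. The condition \<open>Q \<noteq> {}\<close> admits the null graph, in which the
  empty set is both a maximal clique and a maximal stable set.
\<close>

locale claw_free_CIS_graph =
  fixes V :: "'a set" and adj :: "'a \<Rightarrow> 'a \<Rightarrow> bool" (infix \<open>\<sim>\<close> 50)
  assumes finite_V: "finite V"
    and adj_sym: "x \<sim> y \<Longrightarrow> y \<sim> x"
    and adj_irrefl: "\<not> x \<sim> x"
    and no_claw: "\<lbrakk>c \<in> V; x \<in> V; y \<in> V; z \<in> V; c \<sim> x; c \<sim> y; c \<sim> z; x \<noteq> y; x \<noteq> z; y \<noteq> z\<rbrakk>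
      \<Longrightarrow> x \<sim> y \<or> x \<sim> z \<or> y \<sim> z"
    and settled: "\<lbrakk>Q \<subseteq> V; pairwise (\<sim>) Q; Q \<noteq> {}; T \<subseteq> V; pairwise (\<lambda>x y. \<not> x \<sim> y) T\<rbrakk>
      \<Longrightarrow> \<exists>x\<in>V. pairwise (\<sim>) (insert x Q) \<and> pairwise (\<lambda>x y. \<not> x \<sim> y) (insert x T)"
begin

abbreviation is_clique :: "'a set \<Rightarrow> bool" where
  "is_clique Q \<equiv> Q \<subseteq> V \<and> pairwise (\<sim>) Q"

abbreviation is_stable :: "'a set \<Rightarrow> bool" where
  "is_stable T \<equiv> T \<subseteq> V \<and> pairwise (\<lambda>x y. \<not> x \<sim> y) T"

definition closed_nbhd :: "'a set \<Rightarrow> 'a set" where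
  "closed_nbhd T = {x \<in> V. \<exists>t\<in>T. x = t \<or> t \<sim> x}"

lemma adj_commute: "x \<sim> y \<longleftrightarrow> y \<sim> x"
  using adj_sym by blast

section \<open>Induced paths on four vertices and deletion of closed neighbourhoods\<close>

text \<open>Apply \<open>settled\<close> to the clique formed by \<open>b\<close>, \<open>c\<close>
  and \<open>U\<close> and to the stable set \<open>{a, d}\<close>. The vertex obtained lies in
  neither: \<open>a\<close> misses \<open>c\<close>, \<open>d\<close> misses \<open>b\<close>, and
  each vertex of the clique sees \<open>a\<close> or \<open>d\<close>.\<close>

lemma P4_settled:
  assumes "a \<in> V" "b \<in> V" "c \<in> V" "d \<in> V"
    and "a \<sim> b" "b \<sim> c" "c \<sim> d" "\<not> a \<sim> c" "\<not> b \<sim> d" "\<not> a \<sim> d"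
    and "U \<subseteq> V" "pairwise (\<sim>) U" "\<forall>u\<in>U. u \<sim> a \<and> u \<sim> b \<and> u \<sim> c \<and> u \<sim> d"
  shows "\<exists>z\<in>V. z \<sim> b \<and> z \<sim> c \<and> \<not> z \<sim> a \<and> \<not> z \<sim> d \<and> z \<noteq> a \<and> z \<noteq> d \<and> (\<forall>u\<in>U. z \<sim> u)"
proof -
  have "pairwise (\<sim>) (insert b (insert c U))" "pairwise (\<lambda>x y. \<not> x \<sim> y) {a, d}"
    using assms by (auto simp: pairwise_insert adj_commute)
  then obtain z where z: "z \<in> V" "pairwise (\<sim>) (insert z (insert b (insert c U)))"
      "pairwise (\<lambda>x y. \<not> x \<sim> y) (insert z {a, d})"
    using settled[of "insert b (insert c U)" "{a, d}"] assms by auto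
  have q: "z = q \<or> z \<sim> q" if "q \<in> insert b (insert c U)" for q
    using z(2) that by (auto simp: pairwise_def)
  have t: "z = s \<or> \<not> z \<sim> s" if "s \<in> {a, d}" for s
    using z(3) that by (auto simp: pairwise_def)
  have "z \<noteq> a" "z \<noteq> d" using q[of b] q[of c] assms adj_sym adj_irrefl by blast+
  moreover from this have "\<not> z \<sim> a" "\<not> z \<sim> d" using t by blast+
  moreover from this have "z \<noteq> b" "z \<noteq> c" "z \<notin> U" using assms adj_sym by blast+
  ultimately show ?thesis using z(1) q by blast
qed

text \<open>A gem is an induced \<open>P\<^sub>4\<close> together with a vertex \<open>v\<close>
  seeing all of it. With \<open>U = {v}\<close>, the new vertex \<open>z\<close> yields a claw with
  centre \<open>v\<close> and leaves \<open>z\<close>, \<open>a\<close>, \<open>d\<close>.\<close>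

lemma no_gem:
  assumes "v \<in> V" "a \<in> V" "b \<in> V" "c \<in> V" "d \<in> V"
    and "v \<sim> a" "v \<sim> b" "v \<sim> c" "v \<sim> d" "a \<sim> b" "b \<sim> c" "c \<sim> d"
  shows "a \<sim> c \<or> b \<sim> d \<or> a \<sim> d"
proof (rule ccontr)
  assume n: "\<not> ?thesis"
  then obtain z where "z \<in> V" "\<not> z \<sim> a" "\<not> z \<sim> d" "z \<noteq> a" "z \<noteq> d" "v \<sim> z"
    using P4_settled[of a b c d "{v}"] assms adj_sym by auto
  moreover have "a \<noteq> d" using n assms adj_sym by blast
  ultimately show False using no_claw[of v z a d] n assms by blast
qed

text \<open>The vertex that \<open>settled\<close> gives for \<open>Q\<close> and
  \<open>T' \<union> T\<close> survives the deletion: it equals or sees a vertex of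
  \<open>Q\<close>, so it is not in \<open>T\<close>, and then it misses all of
  \<open>T\<close>.\<close>

lemma remove_closed_nbhd:
  assumes T: "is_stable T"
  shows "claw_free_CIS_graph (V - closed_nbhd T) (\<sim>)"
proof
  fix Q T'
  assume Q: "Q \<subseteq> V - closed_nbhd T" "pairwise (\<sim>) Q" "Q \<noteq> {}"
    and T': "T' \<subseteq> V - closed_nbhd T" "pairwise (\<lambda>x y. \<not> x \<sim> y) T'"
  have "pairwise (\<lambda>x y. \<not> x \<sim> y) (T' \<union> T)"
    using T T' unfolding pairwise_def closed_nbhd_def by (blast intro: adj_sym)
  then obtain x where x: "x \<in> V" "pairwise (\<sim>) (insert x Q)"
      "pairwise (\<lambda>x y. \<not> x \<sim> y) (insert x (T' \<union> T))"
    using settled[of Q "T' \<union> T"] Q T T' by auto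
  obtain q where q: "q \<in> Q" using Q by blast
  have "q = x \<or> x \<sim> q" using x(2) q by (auto simp: pairwise_def)
  then have "x \<notin> T" using q Q(1) unfolding closed_nbhd_def by blast
  moreover from this have "\<not> t \<sim> x" if "t \<in> T" for t
    using x(3) that by (metis UnI2 adj_sym insertCI pairwise_def)
  ultimately have "x \<in> V - closed_nbhd T" using x(1) unfolding closed_nbhd_def by blast
  moreover have "pairwise (\<lambda>x y. \<not> x \<sim> y) (insert x T')"
    using x(3) by (rule pairwise_subset) auto
  ultimately show "\<exists>x\<in>V - closed_nbhd T. pairwise (\<sim>) (insert x Q) \<and>
      pairwise (\<lambda>x y. \<not> x \<sim> y) (insert x T')"
    using x(2) by blast
qed (use finite_V in \<open>auto intro: adj_sym simp: adj_irrefl dest: no_claw\<close>)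

section \<open>Neighbourhoods with an induced 4-cycle\<close>

text \<open>
  The complement of such a \<open>C\<close> is triangle-free and \<open>P\<^sub>4\<close>-free, hence a disjoint union of complete
  bipartite graphs; a maximal clique of \<open>C\<close> picks one side of each.
\<close>

lemma co_bipartite_if_no_stable_triple:
  assumes CV: "C \<subseteq> V"
    and closed: "\<And>x y. x \<in> C \<Longrightarrow> y \<in> V \<Longrightarrow> x \<sim> y \<Longrightarrow> y \<in> C"
    and triple: "\<And>x y z. \<lbrakk>x \<in> C; y \<in> C; z \<in> C; x \<noteq> y; x \<noteq> z; y \<noteq> z\<rbrakk> \<Longrightarrow> x \<sim> y \<or> x \<sim> z \<or> y \<sim> z"
  shows "\<exists>K. is_clique K \<and> is_clique (C - K)"
proof -
  have "\<exists>K. (K \<subseteq> C \<and> pairwise (\<sim>) K) \<and> {} \<subseteq> K \<and>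
      (\<forall>Y. (Y \<subseteq> C \<and> pairwise (\<sim>) Y) \<and> K \<subseteq> Y \<longrightarrow> Y = K)"
    by (rule extend_to_maximal[where W = V]) (use CV finite_V in auto)
  then obtain K where K: "K \<subseteq> C" "pairwise (\<sim>) K"
    and max: "\<And>Y. Y \<subseteq> C \<Longrightarrow> pairwise (\<sim>) Y \<Longrightarrow> K \<subseteq> Y \<Longrightarrow> Y = K"
    by metis
  have nonadj: "\<exists>k\<in>K. \<not> x \<sim> k" if "x \<in> C - K" for x
  proof (rule ccontr)
    assume "\<not> ?thesis"
    then have "pairwise (\<sim>) (insert x K)" using K(2) adj_sym by (auto simp: pairwise_insert)
    then show False using max[of "insert x K"] that K(1) by blast
  qed
  have "x \<sim> y" if x: "x \<in> C - K" and y: "y \<in> C - K" and "x \<noteq> y" for x y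
  proof (rule ccontr)
    assume xy: "\<not> x \<sim> y"
    obtain k l where k: "k \<in> K" "\<not> x \<sim> k" and l: "l \<in> K" "\<not> y \<sim> l"
      using nonadj x y by blast
    have "y \<sim> k" using triple[of x y k] x y k K(1) xy \<open>x \<noteq> y\<close> by blast
    have "x \<sim> l" using triple[of x y l] x y l K(1) xy \<open>x \<noteq> y\<close> by blast
    have "l \<sim> k" using K(2) k l \<open>y \<sim> k\<close> unfolding pairwise_def by metis
    have ky: "k \<sim> y" "\<not> l \<sim> y" using \<open>y \<sim> k\<close> l adj_sym by blast+
    \<comment> \<open>The path \<open>x\<close>, \<open>l\<close>, \<open>k\<close>,
      \<open>y\<close> is induced. The vertex \<open>z\<close> sees \<open>l\<close>, hence lies in
      \<open>C\<close>, and forms a stable triple with the ends \<open>x\<close> and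
      \<open>y\<close>.\<close>
    obtain z where z: "z \<in> V" "z \<sim> l" "\<not> z \<sim> x" "\<not> z \<sim> y" "z \<noteq> x" "z \<noteq> y"
      using P4_settled[of x l k y "{}"] \<open>x \<sim> l\<close> \<open>l \<sim> k\<close> ky k l x y xy K(1) CV
      by (auto simp: subset_iff)
    then have "z \<in> C" using closed[of l z] l K(1) adj_sym by blast
    then show False using triple[of z x y] z x y xy \<open>x \<noteq> y\<close> by blast
  qed
  then have "pairwise (\<sim>) (C - K)" unfolding pairwise_def by blast
  then show ?thesis using K CV by blast
qed

text \<open>The set \<open>C\<close> below is the component of the hub \<open>v\<close>: besides
  \<open>v\<close> and its neighbours it contains only \<open>W\<close>, whose vertices see the
  whole rim. It has no stable triple, so two cliques cover it.\<close>

lemma wheel_small_nbhd: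
  assumes V: "v \<in> V" "a \<in> V" "b \<in> V" "c \<in> V" "d \<in> V"
    and hub: "v \<sim> a" "v \<sim> b" "v \<sim> c" "v \<sim> d"
    and rim: "a \<sim> b" "b \<sim> c" "c \<sim> d" "d \<sim> a"
    and nonadj: "\<not> a \<sim> c" "\<not> b \<sim> d" "a \<noteq> c" "b \<noteq> d"
    and w: "\<And>Q. is_clique Q \<Longrightarrow> card Q \<le> w"
  shows "card (closed_nbhd {a, c}) \<le> card {a, c} * w"
proof -
  define W where "W = {x \<in> V. x \<sim> a \<and> x \<sim> b \<and> x \<sim> c \<and> x \<sim> d \<and> x \<noteq> v \<and> \<not> x \<sim> v}"
  define C where "C = {v} \<union> {x \<in> V. v \<sim> x} \<union> W"
  note comm = adj_commute
  \<comment> \<open>Used with \<open>r\<close> on the rim and \<open>p\<close>, \<open>q\<close> its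
    rim neighbours. A claw at \<open>r\<close> forces \<open>x\<close> to see one of them; seeing
    only \<open>p\<close> would leave the gem with path \<open>x\<close>, \<open>p\<close>,
    \<open>v\<close>, \<open>q\<close> around \<open>r\<close>.\<close>
  have rim_step: "x \<sim> p \<and> x \<sim> q"
    if "r \<in> V" "p \<in> V" "q \<in> V" "r \<sim> p" "r \<sim> q" "r \<sim> v" "v \<sim> p" "v \<sim> q" "\<not> p \<sim> q" "p \<noteq> q"
      "x \<in> V" "x \<sim> r" "\<not> x \<sim> v" "x \<noteq> v" for x r p q
  proof -
    have "x \<noteq> p" "x \<noteq> q" using that comm by blast+
    then have "x \<sim> p \<or> x \<sim> q" using no_claw[of r x p q] that comm by blast
    moreover have "x \<sim> p \<Longrightarrow> x \<sim> q"
      using no_gem[of r x p v q] that V comm by blast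
    moreover have "x \<sim> q \<Longrightarrow> x \<sim> p"
      using no_gem[of r x q v p] that V comm by blast
    ultimately show ?thesis by blast
  qed
  have rim_W: "x \<in> W" if "x \<in> V" "x \<sim> r" "r \<in> {a, b, c, d}" "\<not> x \<sim> v" "x \<noteq> v" for x r
  proof -
    have 1: "x \<sim> a \<or> x \<sim> c \<Longrightarrow> x \<sim> b \<and> x \<sim> d"
      using rim_step[of a b d x] rim_step[of c b d x] that V hub rim nonadj comm by blast
    have 2: "x \<sim> b \<or> x \<sim> d \<Longrightarrow> x \<sim> a \<and> x \<sim> c"
      using rim_step[of b a c x] rim_step[of d a c x] that V hub rim nonadj comm by blast
    show ?thesis using 1 2 that unfolding W_def by blast
  qed
  \<comment> \<open>That is, \<open>x\<close> sees at least three rim vertices. Claws at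
    \<open>v\<close> forbid missing two opposite ones; missing two consecutive ones
    \<open>r\<close>, \<open>s\<close> gives the gem with path \<open>x\<close>, \<open>r'\<close>,
    \<open>s\<close>, \<open>r\<close>, where \<open>r'\<close> is opposite to
    \<open>r\<close>.\<close>
  have most: "(x \<sim> a \<and> x \<sim> c \<and> (x \<sim> b \<or> x \<sim> d)) \<or> (x \<sim> b \<and> x \<sim> d \<and> (x \<sim> a \<or> x \<sim> c))"
    if "x \<in> V" "v \<sim> x" "x \<notin> {a, b, c, d}" for x
  proof -
    have 1: "x \<sim> a \<or> x \<sim> c" "x \<sim> b \<or> x \<sim> d"
      using no_claw[of v x a c] no_claw[of v x b d] that V hub nonadj by blast+
    have "\<not> (\<not> x \<sim> r \<and> \<not> x \<sim> s)" if "r \<in> {a, c}" "s \<in> {b, d}" for r s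
    proof -
      define r' where "r' = (if r = a then c else a)"
      have "x \<sim> r' \<or> x \<sim> r" "\<not> r \<sim> r'" "r \<sim> s" "s \<sim> r'" "r' \<in> V" "v \<sim> r'" "r \<in> V" "s \<in> V" "v \<sim> r" "v \<sim> s"
        using 1 that rim nonadj V hub comm unfolding r'_def by (auto split: if_splits)
      then show ?thesis using no_gem[of v x r' s r] \<open>x \<in> V\<close> \<open>v \<sim> x\<close> V comm by blast
    qed
    then show ?thesis using 1 by blast
  qed
  have CV: "C \<subseteq> V" using V unfolding C_def W_def by blast
  have closed: "y \<in> C" if "x \<in> C" "y \<in> V" "x \<sim> y" for x y
  proof (cases "y = v \<or> v \<sim> y")
    case True
    then show ?thesis using that unfolding C_def by blast
  next
    case False
    \<comment> \<open>If \<open>x\<close> is off the rim, it sees two opposite rim vertices, and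
      \<open>y\<close> must see one of them to avoid a claw at \<open>x\<close>.\<close>
    have "\<exists>r\<in>{a, b, c, d}. y \<sim> r"
    proof (cases "x \<in> W")
      case True
      then have "y = a \<or> y = c \<or> y \<sim> a \<or> y \<sim> c"
        using no_claw[of x y a c] that V nonadj comm unfolding W_def by blast
      then show ?thesis using False hub by blast
    next
      case xW: False
      then have vx: "v \<sim> x" "x \<in> V" using that False unfolding C_def by auto
      show ?thesis
      proof (cases "x \<in> {a, b, c, d}")
        case True
        then show ?thesis using that adj_sym by blast
      next
        case xr: False
        have ne: "y \<notin> {a, b, c, d}" using False hub by blast
        show ?thesis
          using most[OF vx(2,1) xr] no_claw[of x y a c] no_claw[of x y b d] ne that vx V nonadj by blast
      qed
    qed
    then show ?thesis using rim_W[of y] that False comm unfolding C_def by blast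
  qed
  have W_clique: "x \<sim> y" if "x \<in> W" "y \<in> W" "x \<noteq> y" for x y
    using no_claw[of a v x y] that V hub adj_sym unfolding W_def by blast
  \<comment> \<open>Both \<open>x\<close> and \<open>y\<close> see three of the four rim vertices,
    so they share a rim neighbour \<open>r\<close>. It also sees \<open>z\<close>, which makes a
    claw at \<open>r\<close>.\<close>
  have aux: False
    if x: "x \<in> V" "v \<sim> x" and y: "y \<in> V" "v \<sim> y" and z: "z \<in> W"
      and "x \<noteq> y" "\<not> x \<sim> y" "\<not> x \<sim> z" "\<not> y \<sim> z" for x y z
  proof -
    have nr: "x \<notin> {a, b, c, d}" "y \<notin> {a, b, c, d}" using that comm unfolding W_def by blast+
    obtain r where r: "r \<in> {a, b, c, d}" "x \<sim> r" "y \<sim> r"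
      using most[OF x nr(1)] most[OF y nr(2)] by blast
    have "r \<in> V" "z \<in> V" "z \<sim> r" "x \<noteq> z" "y \<noteq> z" using r z V that comm unfolding W_def by blast+
    then show False using no_claw[of r x y z] r that comm by blast
  qed
  have triple: "x \<sim> y \<or> x \<sim> z \<or> y \<sim> z"
    if "x \<in> C" "y \<in> C" "z \<in> C" "x \<noteq> y" "x \<noteq> z" "y \<noteq> z" for x y z
  proof (rule ccontr)
    assume n: "\<not> ?thesis"
    define D where "D = {x \<in> V. v \<sim> x}"
    \<comment> \<open>The hub is in no stable triple: the other two vertices would lie in the clique
      \<open>W\<close>.\<close>
    have C: "x \<in> D \<or> x \<in> W" if "x \<in> C" "y \<in> C" "z \<in> C" "x \<noteq> y" "x \<noteq> z" "y \<noteq> z"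
        "\<not> x \<sim> y" "\<not> x \<sim> z" "\<not> y \<sim> z" for x y z
      using W_clique[of y z] that unfolding C_def D_def by blast
    have mem: "x \<in> D \<or> x \<in> W" "y \<in> D \<or> y \<in> W" "z \<in> D \<or> z \<in> W"
      using C[of x y z] C[of y x z] C[of z x y] that n comm by blast+
    have "\<not> (x \<in> D \<and> y \<in> D \<and> z \<in> D)"
      using no_claw[of v x y z] that n V unfolding D_def by blast
    then show False
      using mem W_clique[of x y] W_clique[of x z] W_clique[of y z] aux[of x y z] aux[of x z y]
        aux[of y z x] that n comm unfolding D_def by blast
  qed
  have "\<exists>K. is_clique K \<and> is_clique (C - K)"
    by (rule co_bipartite_if_no_stable_triple) (fact CV closed triple)+
  then obtain K where K: "is_clique K" "is_clique (C - K)" by blast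
  have "closed_nbhd {a, c} \<subseteq> C"
  proof
    fix x assume "x \<in> closed_nbhd {a, c}"
    then have "x \<in> V" "x \<in> {a, c} \<or> a \<sim> x \<or> c \<sim> x" unfolding closed_nbhd_def by auto
    moreover have "a \<in> C" "c \<in> C" using V hub unfolding C_def by auto
    ultimately show "x \<in> C" using closed by auto
  qed
  then have "card (closed_nbhd {a, c}) \<le> card (K \<union> (C - K))"
    using K finite_V by (intro card_mono) (auto intro: finite_subset)
  also have "\<dots> \<le> card K + card (C - K)" by (rule card_Un_le)
  also have "\<dots> \<le> w + w" using w K by (intro add_mono) auto
  finally show ?thesis using nonadj by simp
qed

section \<open>Counting maximal cliques\<close>

definition max_cliques :: "'a set set" where
  "max_cliques = {K. is_clique K \<and> (\<forall>L. is_clique L \<and> K \<subseteq> L \<longrightarrow> L = K)}"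

text \<open>The two cliques are \<open>side x\<close> and \<open>side y\<close>, where
  \<open>side p\<close> consists of \<open>v\<close>, \<open>p\<close> and their common
  neighbours.\<close>

lemma max_cliques_at_vertex:
  assumes V: "v \<in> V" "x \<in> V" "y \<in> V"
    and vxy: "v \<sim> x" "v \<sim> y" "\<not> x \<sim> y" "x \<noteq> y"
    and no_wheel: "\<And>a b c d. \<lbrakk>a \<in> V; b \<in> V; c \<in> V; d \<in> V; v \<sim> a; v \<sim> b; v \<sim> c; v \<sim> d;
      a \<sim> b; b \<sim> c; c \<sim> d; d \<sim> a; a \<noteq> c; b \<noteq> d\<rbrakk> \<Longrightarrow> a \<sim> c \<or> b \<sim> d"
  shows "card {K \<in> max_cliques. v \<in> K} = 2"
proof -
  note comm = adj_commute
  define side where "side p = insert v {z \<in> V. v \<sim> z \<and> (z = p \<or> z \<sim> p)}" for p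
  have side_clique: "is_clique (side p)"
    if pq: "p \<in> V" "q \<in> V" "v \<sim> p" "v \<sim> q" "\<not> p \<sim> q" "p \<noteq> q" for p q
  proof -
    \<comment> \<open>Otherwise a claw at \<open>v\<close> makes \<open>s\<close> or
      \<open>t\<close> see \<open>q\<close>. If only one does, the neighbourhood of \<open>v\<close>
      contains an induced \<open>P\<^sub>4\<close>; if both do, it contains the 4-cycle
      \<open>p\<close>, \<open>s\<close>, \<open>q\<close>, \<open>t\<close>.\<close>
    have "s \<sim> t" if s: "s \<in> V" "v \<sim> s" "s \<sim> p" and t: "t \<in> V" "v \<sim> t" "t \<sim> p" and "s \<noteq> t" for s t
    proof (rule ccontr)
      assume n: "\<not> s \<sim> t"
      have ne: "s \<noteq> q" "t \<noteq> q" using s t pq comm by blast+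
      then have "s \<sim> q \<or> t \<sim> q"
        using no_claw[of v s t q] n s t pq V \<open>s \<noteq> t\<close> comm by blast
      then show False
        using no_gem[of v s p t q] no_gem[of v t p s q] no_wheel[of p s q t] n s t pq V \<open>s \<noteq> t\<close> comm by blast
    qed
    then show ?thesis
      using V comm unfolding side_def pairwise_def by blast
  qed
  have sub: "K \<subseteq> side x \<or> K \<subseteq> side y" if K: "is_clique K" "v \<in> K" for K
  proof (rule ccontr)
    assume "\<not> ?thesis"
    then obtain s t where st: "s \<in> K" "s \<notin> side x" "t \<in> K" "t \<notin> side y" by blast
    have sV: "s \<in> V" "v \<sim> s" "t \<in> V" "v \<sim> t"
      using K st by (auto simp: side_def pairwise_def)
    \<comment> \<open>By claws at \<open>v\<close>, \<open>s\<close> equals or sees \<open>y\<close>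
      and \<open>t\<close> equals or sees \<open>x\<close>, so \<open>x\<close>, \<open>t\<close>,
      \<open>s\<close>, \<open>y\<close> is the path of a gem; coincidences contradict the
      non-adjacencies directly.\<close>
    have n: "\<not> s \<sim> x" "s \<noteq> x" "\<not> t \<sim> y" "t \<noteq> y" using st sV unfolding side_def by auto
    have "s = y \<or> s \<sim> y" "t = x \<or> t \<sim> x"
      using no_claw[of v s x y] no_claw[of v t x y] sV n V vxy by blast+
    moreover have "s = t \<or> s \<sim> t" using K st unfolding pairwise_def by blast
    ultimately show False using no_gem[of v x t s y] sV n V vxy by (metis comm)
  qed
  have ne: "x \<in> side x" "x \<notin> side y" "y \<in> side y" "y \<notin> side x"
    using V vxy comm adj_irrefl unfolding side_def by auto
  have "{K \<in> max_cliques. v \<in> K} = {side x, side y}"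
  proof (intro equalityI subsetI)
    fix K assume "K \<in> {K \<in> max_cliques. v \<in> K}"
    then show "K \<in> {side x, side y}"
      using sub[of K] side_clique[of x y] side_clique[of y x] V vxy comm unfolding max_cliques_def by blast
  next
    fix K assume K: "K \<in> {side x, side y}"
    have vK: "v \<in> K" "is_clique K"
      using K side_clique[of x y] side_clique[of y x] V vxy comm by (auto simp: side_def)
    have "L = K" if L: "is_clique L" "K \<subseteq> L" for L
      using sub[of L] L K vK ne by blast
    then show "K \<in> {K \<in> max_cliques. v \<in> K}" using vK unfolding max_cliques_def by blast
  qed
  moreover have "side x \<noteq> side y" using ne by blast
  ultimately show ?thesis by simp
qed

lemma stable_set_if_two_max_cliques:
  assumes two: "\<And>v. v \<in> V \<Longrightarrow> card {K \<in> max_cliques. v \<in> K} = 2"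
    and w: "\<And>Q. is_clique Q \<Longrightarrow> card Q \<le> w"
  shows "\<exists>S. is_stable S \<and> card V \<le> card S * w"
\<comment> \<open>On the empty vertex set the empty clique is maximal and meets no stable set, so
  \<open>one\<close> would fail.\<close>
proof (cases "V = {}")
  case True
  then show ?thesis by (intro exI[of _ "{}"]) auto
next
  case nonempty: False
  obtain S where S: "is_stable S" and Smax: "\<And>T. is_stable T \<Longrightarrow> S \<subseteq> T \<Longrightarrow> T = S"
    using extend_to_maximal[of is_stable "{}" V] finite_V by auto
  have finM: "finite max_cliques"
    by (rule finite_subset[of _ "Pow V"]) (auto simp: max_cliques_def finite_V)
  have finS: "finite S" using S finite_V finite_subset by blast
  have one: "card {x \<in> S. x \<in> K} = 1" if "K \<in> max_cliques" for K
  proof -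
    have K: "is_clique K" "\<And>L. is_clique L \<Longrightarrow> K \<subseteq> L \<Longrightarrow> L = K"
      using that unfolding max_cliques_def by blast+
    have "K \<noteq> {}"
      using K(2)[of "{SOME v. v \<in> V}"] nonempty by (auto simp: some_in_eq)
    then obtain x where x: "x \<in> V" "pairwise (\<sim>) (insert x K)" "pairwise (\<lambda>x y. \<not> x \<sim> y) (insert x S)"
      using settled[of K S] K S by blast
    have "x \<in> K" "x \<in> S"
      using K(2)[of "insert x K"] Smax[of "insert x S"] x K(1) S by blast+
    then have "{x \<in> S. x \<in> K} = {x}" using K(1) S unfolding pairwise_def by blast
    then show ?thesis by simp
  qed
  \<comment> \<open>Incidences between vertices and maximal cliques are counted in two ways, first
    over \<open>S\<close>, then over \<open>V\<close>.\<close>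
  have "(\<Sum>K\<in>max_cliques. card {x \<in> S. x \<in> K}) = 2 * card S"
    by (rule sum_multicount) (use finM finS two S in auto)
  then have M: "card max_cliques = 2 * card S" using one by simp
  have "2 * card V = (\<Sum>K\<in>max_cliques. card {x \<in> V. x \<in> K})"
    by (rule sum_multicount[symmetric]) (use finM finite_V two in auto)
  also have "\<dots> \<le> card max_cliques * w"
  proof (rule sum_bounded_above[of _ _ w, simplified])
    fix K assume "K \<in> max_cliques"
    then have "is_clique K" unfolding max_cliques_def by blast
    moreover from this have "{x \<in> V. x \<in> K} = K" by blast
    ultimately show "card {x \<in> V. x \<in> K} \<le> w" using w by simp
  qed
  finally show ?thesis using S M by auto
qed

section \<open>Induction on the number of vertices\<close>

text \<open>If no \<open>T\<close> qualifies, \<open>T = {v}\<close> shows that \<open>v\<close> has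
  two non-adjacent neighbours, and \<open>T = {a, c}\<close> excludes wheels around
  \<open>v\<close>.\<close>

lemma reducible_or_two_max_cliques:
  assumes w: "\<And>Q. is_clique Q \<Longrightarrow> card Q \<le> w"
  shows "(\<exists>T. is_stable T \<and> T \<noteq> {} \<and> card (closed_nbhd T) \<le> card T * w) \<or>
    (\<forall>v\<in>V. card {K \<in> max_cliques. v \<in> K} = 2)"
proof -
  have "card {K \<in> max_cliques. v \<in> K} = 2"
    if irr: "\<nexists>T. is_stable T \<and> T \<noteq> {} \<and> card (closed_nbhd T) \<le> card T * w" and v: "v \<in> V" for v
  proof -
    have "\<exists>x\<in>V. \<exists>y\<in>V. v \<sim> x \<and> v \<sim> y \<and> \<not> x \<sim> y \<and> x \<noteq> y"
    proof (rule ccontr)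
      assume "\<not> ?thesis"
      then have "is_clique (closed_nbhd {v})"
        using adj_sym unfolding closed_nbhd_def pairwise_def by blast
      then have "card (closed_nbhd {v}) \<le> card {v} * w" using w by simp
      then show False using irr v by (metis empty_not_insert empty_subsetI insert_subset pairwise_singleton)
    qed
    then obtain x y where xy: "x \<in> V" "y \<in> V" "v \<sim> x" "v \<sim> y" "\<not> x \<sim> y" "x \<noteq> y" by blast
    show ?thesis
    proof (rule max_cliques_at_vertex[OF v xy])
      fix a b c d
      assume A: "a \<in> V" "b \<in> V" "c \<in> V" "d \<in> V" "v \<sim> a" "v \<sim> b" "v \<sim> c" "v \<sim> d"
        "a \<sim> b" "b \<sim> c" "c \<sim> d" "d \<sim> a" "a \<noteq> c" "b \<noteq> d"
      show "a \<sim> c \<or> b \<sim> d"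
      proof (rule ccontr)
        assume n: "\<not> ?thesis"
        then have "card (closed_nbhd {a, c}) \<le> card {a, c} * w"
          using wheel_small_nbhd[OF v A(1-12) _ _ A(13,14) w] by blast
        moreover have "is_stable {a, c}" using A n adj_sym by (auto simp: pairwise_insert)
        ultimately show False using irr by blast
      qed
    qed
  qed
  then show ?thesis by blast
qed

end

text \<open>Any upper bound \<open>w\<close> on clique sizes is inherited by vertex subsets, so it
  stays fixed in the induction. An explicit \<open>S\<close> is produced so that the deleted
  \<open>T\<close> can be added to it.\<close>

lemma claw_free_CIS_graph_order_bound:
  assumes "claw_free_CIS_graph V adj"
    and "\<And>Q. Q \<subseteq> V \<Longrightarrow> pairwise adj Q \<Longrightarrow> card Q \<le> w"
  shows "\<exists>S\<subseteq>V. pairwise (\<lambda>x y. \<not> adj x y) S \<and> card V \<le> card S * w"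
  using assms
proof (induction "card V" arbitrary: V rule: less_induct)
  case less
  interpret claw_free_CIS_graph V adj by fact
  have w: "\<And>Q. is_clique Q \<Longrightarrow> card Q \<le> w" using less.prems by blast
  then consider (two) "\<forall>v\<in>V. card {K \<in> max_cliques. v \<in> K} = 2"
    | (reducible) T where "is_stable T" "T \<noteq> {}" "card (closed_nbhd T) \<le> card T * w"
    using reducible_or_two_max_cliques[of w] by blast
  then show ?case
  proof cases
    case two
    have "\<exists>S. is_stable S \<and> card V \<le> card S * w"
      by (rule stable_set_if_two_max_cliques) (use two w in auto)
    then show ?thesis by blast
  next
    case (reducible T)
    define N where "N = closed_nbhd T"
    have N: "N \<subseteq> V" "T \<subseteq> N" "finite N"
      using reducible finite_V unfolding N_def closed_nbhd_def by auto
    have "card (V - N) < card V"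
      using N reducible finite_V by (intro psubset_card_mono) auto
    then obtain S where S: "S \<subseteq> V - N" "pairwise (\<lambda>x y. \<not> adj x y) S" "card (V - N) \<le> card S * w"
      using less.hyps[of "V - N"] remove_closed_nbhd[of T] reducible w unfolding N_def by blast
    have "pairwise (\<lambda>x y. \<not> adj x y) (S \<union> T)"
      using S reducible adj_sym unfolding pairwise_def N_def closed_nbhd_def by blast
    moreover have "card (S \<union> T) = card S + card T"
      using S N finite_V by (intro card_Un_disjoint) (auto intro: finite_subset)
    moreover have "card V = card (V - N) + card N"
      using N finite_V by (metis card_Diff_subset card_mono le_add_diff_inverse2)
    ultimately have "S \<union> T \<subseteq> V \<and> pairwise (\<lambda>x y. \<not> adj x y) (S \<union> T) \<and> card V \<le> card (S \<union> T) * w"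
      using S reducible N unfolding N_def[symmetric] by (auto simp: add_mult_distrib)
    then show ?thesis by blast
  qed
qed

section \<open>From digraphs to the axiomatic setting\<close>

text \<open>Otherwise the four vertices induce a complete bipartite graph with parts
  \<open>{c}\<close> and \<open>{x, y, z}\<close>.\<close>

lemma claw_free_no_claw:
  assumes G: "graph G" and "claw_free G"
    and c: "c \<rightarrow>\<^bsub>G\<^esub> x" "c \<rightarrow>\<^bsub>G\<^esub> y" "c \<rightarrow>\<^bsub>G\<^esub> z" and ne: "x \<noteq> y" "x \<noteq> z" "y \<noteq> z"
  shows "x \<rightarrow>\<^bsub>G\<^esub> y \<or> x \<rightarrow>\<^bsub>G\<^esub> z \<or> y \<rightarrow>\<^bsub>G\<^esub> z"
proof (rule ccontr)
  assume n: "\<not> ?thesis"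
  interpret graph G by fact
  have sym: "u \<rightarrow>\<^bsub>G\<^esub> v \<Longrightarrow> v \<rightarrow>\<^bsub>G\<^esub> u" for u v
    using sym_arcs unfolding symmetric_def sym_def by blast
  have irrefl: "\<not> u \<rightarrow>\<^bsub>G\<^esub> u" for u using adj_not_same by blast
  let ?H = "G \<restriction> {c, x, y, z}"
  have sub: "{c, x, y, z} \<subseteq> verts G" using c adj_in_verts by blast
  have ind: "induced_subgraph ?H G" using sub by (rule induced_induce)
  have arcs: "arcs_ends ?H = arcs_ends G \<inter> {c, x, y, z} \<times> {c, x, y, z}"
    by (auto simp: arcs_ends_conv)
  have "arcs_ends ?H = {c} \<times> {x, y, z} \<union> {x, y, z} \<times> {c}"
    using c n sym irrefl unfolding arcs by auto
  moreover have "verts ?H = {c} \<union> {x, y, z}" "{c} \<inter> {x, y, z} = {}" "card {c} = 1" "card {x, y, z} = 3"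
    using c irrefl ne by auto
  moreover have "graph ?H"
  proof -
    interpret H: digraph ?H using ind by (rule digraphI_induced)
    interpret H: sym_digraph ?H using ind by (rule induced_graph_imp_graph)
    show ?thesis by unfold_locales
  qed
  ultimately have "complete_bipartite_digraph 1 3 ?H"
    unfolding complete_bipartite_digraph_def by blast
  then show False using ind \<open>claw_free G\<close> unfolding claw_free_def by blast
qed

lemma claw_free_CIS_graph_if_CIS:
  assumes G: "graph G" and claw: "claw_free G" and CIS: "CIS G"
  shows "claw_free_CIS_graph (verts G) (dominates G)"
proof -
  interpret graph G by fact
  show ?thesis
  proof
    show "finite (verts G)" by simp
    show "v \<rightarrow>\<^bsub>G\<^esub> u" if "u \<rightarrow>\<^bsub>G\<^esub> v" for u v
      using sym_arcs that unfolding symmetric_def sym_def by blast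
    show "\<not> u \<rightarrow>\<^bsub>G\<^esub> u" for u using adj_not_same by blast
    show "x \<rightarrow>\<^bsub>G\<^esub> y \<or> x \<rightarrow>\<^bsub>G\<^esub> z \<or> y \<rightarrow>\<^bsub>G\<^esub> z"
      if "c \<rightarrow>\<^bsub>G\<^esub> x" "c \<rightarrow>\<^bsub>G\<^esub> y" "c \<rightarrow>\<^bsub>G\<^esub> z" "x \<noteq> y" "x \<noteq> z" "y \<noteq> z" for c x y z
      using claw_free_no_claw[OF G claw that] .
  next
    fix Q T
    assume QT: "Q \<subseteq> verts G" "pairwise (dominates G) Q" "T \<subseteq> verts G" "pairwise (\<lambda>x y. \<not> x \<rightarrow>\<^bsub>G\<^esub> y) T"
    have "\<exists>K. clique G K \<and> Q \<subseteq> K \<and> (\<forall>L. clique G L \<and> K \<subseteq> L \<longrightarrow> L = K)"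
      by (rule extend_to_maximal[where W = "verts G"])
        (use QT in \<open>auto simp: clique_def pairwise_def\<close>)
    then obtain K where K: "maximal_clique G K" "Q \<subseteq> K"
      unfolding maximal_clique_def by blast
    have "\<exists>S. stable_set G S \<and> T \<subseteq> S \<and> (\<forall>R. stable_set G R \<and> S \<subseteq> R \<longrightarrow> R = S)"
      by (rule extend_to_maximal[where W = "verts G"])
        (use QT in \<open>auto simp: stable_set_def pairwise_def\<close>)
    then obtain S where S: "maximal_stable_set G S" "T \<subseteq> S"
      unfolding maximal_stable_set_def by blast
    obtain x where x: "x \<in> K" "x \<in> S" using CIS K S unfolding CIS_def by blast
    have "pairwise (dominates G) K" "K \<subseteq> verts G"
      using K unfolding maximal_clique_def clique_def pairwise_def by blast+
    moreover have "pairwise (\<lambda>x y. \<not> x \<rightarrow>\<^bsub>G\<^esub> y) S"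
      using S unfolding maximal_stable_set_def stable_set_def pairwise_def by blast
    ultimately show "\<exists>x\<in>verts G. pairwise (dominates G) (insert x Q) \<and>
        pairwise (\<lambda>x y. \<not> x \<rightarrow>\<^bsub>G\<^esub> y) (insert x T)"
      using x K(2) S(2) by (meson insert_subset pairwise_subset subsetD)
  qed
qed

theorem theorem18:
  fixes G :: "('a, 'b) pre_digraph"
  assumes "graph G"
    and "verts G \<noteq> {}"
    and "claw_free G"
    and "CIS G"
  shows "card (verts G) \<le> stability_number G * clique_number G"
proof -
  interpret graph G by fact
  have fin: "finite {K. clique G K}" "finite {S. stable_set G S}"
    by (rule finite_subset[of _ "Pow (verts G)"]; auto simp: clique_def stable_set_def)+
  \<comment> \<open>This makes \<open>clique_number G\<close> a valid choice of
    \<open>w\<close>.\<close>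
  have "card Q \<le> clique_number G" if "Q \<subseteq> verts G" "pairwise (dominates G) Q" for Q
    unfolding clique_number_def
    by (intro Max_ge finite_imageI fin imageI) (use that in \<open>auto simp: clique_def pairwise_def\<close>)
  then obtain S where S: "S \<subseteq> verts G" "pairwise (\<lambda>x y. \<not> x \<rightarrow>\<^bsub>G\<^esub> y) S"
      "card (verts G) \<le> card S * clique_number G"
    using claw_free_CIS_graph_order_bound[OF claw_free_CIS_graph_if_CIS[OF assms(1,3,4)]] by blast
  have "card S \<le> stability_number G"
    unfolding stability_number_def
    by (intro Max_ge finite_imageI fin imageI) (use S in \<open>auto simp: stable_set_def pairwise_def\<close>)
  then show ?thesis using S(3) by (meson le_trans mult_le_mono1)
qed

end
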